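(* Let $n\ge1$ and let $g\colon(\mathbb C\setminus\mathbb R)^n\to\mathbb C$ be a Cauchy-type function given by a measure $\mu$. Then $$\int_{\mathbb R^n}\varphi(\boldsymbol t)\,d\mu(\boldsymbol t)=\lim_{\boldsymbol y\to\boldsymbol 0^+}\frac1{2i}\int_{\mathbb R^n}\varphi(\boldsymbol x)\bigg[\sum_{B\subseteq\{1,\ldots,n\}}(-1)^{|B|}g\big(\Psi_B(\boldsymbol x+i\boldsymbol y,\boldsymbol x+i\boldsymbol y)\big)\bigg]d\boldsymbol x$$ for all $\mathcal C^1$-functions $\varphi\colon\mathbb R^n\to\mathbb R$ for which there exists a constant $D\ge0$ such that $|\varphi(\boldsymbol x)|\le D\prod_{j=1}^n(1+x_j^2)^{-1}$ for all $\boldsymbol x\in\mathbb R^n$.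
   Context: Notation: $i$ is the imaginary unit; $\boldsymbol y\to\boldsymbol0^+$ means that $\boldsymbol y\in(0,\infty)^n$ and $\boldsymbol y$ tends to $\boldsymbol 0$. The map $\Psi_B$: for $B\subseteq\{1,\ldots,n\}$ and $\boldsymbol z,\boldsymbol w\in\mathbb C^n$, $\Psi_B(\boldsymbol z,\boldsymbol w):=\boldsymbol\zeta$ with $\zeta_j:=z_j$ if $j\notin B$ and $\zeta_j:=\overline{w_j}$ if $j\in B$. Kernel: for $\boldsymbol z\in(\mathbb C\setminus\mathbb R)^n$, $\boldsymbol t\in\mathbb R^n$, $$K_n(\boldsymbol z,\boldsymbol t):=i\left(\frac{2}{(2i)^n}\prod_{\ell=1}^n\Big(\frac1{t_\ell-z_\ell}-\frac1{t_\ell+i}\Big)-\frac1{(2i)^n}\prod_{\ell=1}^n\Big(\frac1{t_\ell-i}-\frac1{t_\ell+i}\Big)\right).$$ Cauchy-type function: a function $g\colon(\mathbb C\setminus\mathbb R)^n\to\mathbb C$ is a Cauchy-type function (given by the measure $\mu$) if $\mu$ is a positive Borel measure on $\mathbb R^n$ satisfying the growth condition $\int_{\mathbb R^n}\prod_{\ell=1}^n\frac1{1+t_\ell^2}\,d\mu(\boldsymbol t)<\infty$ and $$g(\boldsymbol z)=\frac1{\pi^n}\int_{\mathbb R^n}K_n(\boldsymbol z,\boldsymbol t)\,d\mu(\boldsymbol t)\qquad\text{for every }\boldsymbol z\in(\mathbb C\setminus\mathbb R)^n.$$ *)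

theory Defs
  imports "HOL-Analysis.Analysis"
begin

definition nonreal_vecs :: "(complex ^ 'n) set" where
  "nonreal_vecs = {z. \<forall>l. z $ l \<notin> \<real>}"

definition complex_vec :: "real ^ 'n \<Rightarrow> real ^ 'n \<Rightarrow> complex ^ 'n" where
  "complex_vec x y = (\<chi> j. complex_of_real (x $ j) + \<i> * complex_of_real (y $ j))"

definition Psi :: "'n set \<Rightarrow> complex ^ 'n \<Rightarrow> complex ^ 'n \<Rightarrow> complex ^ 'n" where
  "Psi B z w = (\<chi> j. if j \<in> B then cnj (w $ j) else z $ j)"

definition Kn :: "complex ^ 'n \<Rightarrow> real ^ 'n \<Rightarrow> complex" where
  "Kn z t = \<i> *
     (2 / (2 * \<i>) ^ CARD('n) *
        (\<Prod>l\<in>UNIV. 1 / (complex_of_real (t $ l) - z $ l) - 1 / (complex_of_real (t $ l) + \<i>))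
      - 1 / (2 * \<i>) ^ CARD('n) *
        (\<Prod>l\<in>UNIV. 1 / (complex_of_real (t $ l) - \<i>) - 1 / (complex_of_real (t $ l) + \<i>)))"

text \<open>
  The function \<open>g\<close> is total in HOL; only its values on \<open>nonreal_vecs\<close> are
  constrained. The growth condition makes \<open>Kn z\<close> integrable for every such \<open>z\<close>, so the
  Bochner integral below never takes its default value for a non-integrable function.
\<close>

definition Cauchy_type_function :: "(complex ^ 'n \<Rightarrow> complex) \<Rightarrow> (real ^ 'n) measure \<Rightarrow> bool" where
  "Cauchy_type_function g \<mu> \<longleftrightarrow>
     sets \<mu> = sets borel \<and>
     (\<integral>\<^sup>+ t. ennreal (\<Prod>l\<in>UNIV. 1 / (1 + (t $ l)\<^sup>2)) \<partial>\<mu>) < \<infinity> \<and>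
     (\<forall>z\<in>nonreal_vecs. g z = 1 / complex_of_real pi ^ CARD('n) * (\<integral>t. Kn z t \<partial>\<mu>))"

text \<open>
  The derivative is a map into the normed space of bounded linear functionals; its
  continuity is continuity in operator norm, which for a finite-dimensional domain is
  the same as continuity of all partial derivatives.
\<close>

definition C1_function :: "(real ^ 'n \<Rightarrow> real) \<Rightarrow> bool" where
  "C1_function \<phi> \<longleftrightarrow>
     (\<exists>\<phi>' :: real ^ 'n \<Rightarrow> ((real ^ 'n) \<Rightarrow>\<^sub>L real).
        (\<forall>x. (\<phi> has_derivative blinfun_apply (\<phi>' x)) (at x)) \<and> continuous_on UNIV \<phi>')"

end

theory Submission imports Defs
begin

text \<open>
  In the alternating sum over \<open>B\<close> the part of \<open>Kn\<close> that does not depend on \<open>z\<close> cancels, while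
  the product part becomes \<open>\<Prod>l. 1 / (t l - z l) - 1 / (t l - cnj (z l))\<close>, which up to constants
  is the Poisson kernel of the product of half-planes. By Fubini the integral in question is
  therefore the \<open>\<mu>\<close>-integral of the Poisson mean of \<open>\<phi>\<close> at scale \<open>y\<close>. These means converge
  pointwise to \<open>\<phi>\<close> because the kernel is an approximate identity. The Poisson mean of
  \<open>1 / (1 + x\<^sup>2)\<close> is at most \<open>(2 + 2 * y) / (1 + t\<^sup>2)\<close>, so the decay of \<open>\<phi>\<close> survives averaging,
  and the growth condition on \<open>\<mu>\<close> permits dominated convergence.
\<close>

section \<open>The Poisson kernel of a half-plane\<close>

definition poisson1 :: "real \<Rightarrow> real \<Rightarrow> real" where
  "poisson1 y x = y / (pi * (x\<^sup>2 + y\<^sup>2))"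

lemma poisson1_nonneg: "0 \<le> y \<Longrightarrow> 0 \<le> poisson1 y x"
  by (simp add: poisson1_def)

lemma borel_measurable_poisson1 [measurable]: "poisson1 y \<in> borel_measurable borel"
  unfolding poisson1_def by measurable

lemma nn_integral_inverse_1_plus_square:
  "(\<integral>\<^sup>+x. ennreal (1 / (1 + x\<^sup>2)) \<partial>lborel) = ennreal pi"
proof -
  let ?f = "\<lambda>x::real. ennreal (1 / (1 + x\<^sup>2))"
  have half: "(\<integral>\<^sup>+x. ?f x * indicator {0..} x \<partial>lborel) = ennreal (pi / 2)"
  proof (subst nn_integral_FTC_atLeast[where F=arctan and T="pi / 2"])
    show "(arctan has_real_derivative 1 / (1 + x\<^sup>2)) (at x)" for x :: real
      using DERIV_arctan[of x] by (simp add: inverse_eq_divide)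
  qed (simp_all add: tendsto_arctan_at_top)
  have half': "(\<integral>\<^sup>+x. ?f x * indicator {..0} x \<partial>lborel) = ennreal (pi / 2)"
  proof -
    have "(\<integral>\<^sup>+x. ?f x * indicator {..0} x \<partial>lborel)
        = (\<integral>\<^sup>+x. ?f x * indicator {0..} x \<partial>lborel)"
      by (subst nn_integral_real_affine[where c="-1" and t=0])
         (auto intro!: nn_integral_cong split: split_indicator)
    with half show ?thesis by simp
  qed
  have "(\<integral>\<^sup>+x. ?f x \<partial>lborel)
      = (\<integral>\<^sup>+x. ?f x * indicator {0..} x + ?f x * indicator {..0} x \<partial>lborel)"
    \<comment> \<open>Both half-lines contain \<open>0\<close>, so the two integrands differ at that
      point, which is a null set.\<close>
    by (intro nn_integral_cong_AE eventually_mono[OF AE_lborel_singleton[of 0]])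
       (auto split: split_indicator)
  also have "\<dots> = ennreal (pi / 2) + ennreal (pi / 2)"
    by (simp add: nn_integral_add half half')
  also have "\<dots> = ennreal pi"
    by (simp flip: ennreal_plus)
  finally show ?thesis .
qed

text \<open>Substituting \<open>t + y * x\<close> for \<open>x\<close> turns the kernel into the
  standard Cauchy density, whatever the scale.\<close>

lemma nn_integral_poisson1:
  assumes "y > 0"
  shows "(\<integral>\<^sup>+x. ennreal (poisson1 y (x - t)) \<partial>lborel) = 1"
proof -
  have "(\<integral>\<^sup>+x. ennreal (poisson1 y (x - t)) \<partial>lborel)
      = ennreal y * (\<integral>\<^sup>+x. ennreal (poisson1 y (y * x)) \<partial>lborel)"
    using assms by (subst nn_integral_real_affine[where c=y and t=t]) auto
  also have "\<dots> = (\<integral>\<^sup>+x. ennreal (1 / pi) * ennreal (1 / (1 + x\<^sup>2)) \<partial>lborel)"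
  proof -
    have "y * poisson1 y (y * x) = 1 / pi * (1 / (1 + x\<^sup>2))" for x
    proof -
      have "(y * x)\<^sup>2 + y\<^sup>2 = y\<^sup>2 * (1 + x\<^sup>2)"
        by (simp add: algebra_simps)
      then show ?thesis
        using assms by (simp add: poisson1_def power2_eq_square)
    qed
    then show ?thesis
      using assms by (subst nn_integral_cmult[symmetric])
        (auto intro!: nn_integral_cong simp: poisson1_nonneg simp flip: ennreal_mult)
  qed
  also have "\<dots> = 1"
    by (subst nn_integral_cmult)
       (simp_all add: nn_integral_inverse_1_plus_square flip: ennreal_mult)
  finally show ?thesis .
qed

text \<open>By the semigroup law of Poisson kernels the left side is exactly
  \<open>(1 + y) / (t^2 + (1 + y)^2)\<close>. An elementary estimate that loses a factor 2 suffices: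
  \<open>1 + t^2\<close> is split into a multiple of \<open>1 + x^2\<close>, which cancels the
  weight and leaves the kernel of mass one, and a multiple of \<open>(x - t)^2\<close>, which the
  kernel absorbs up to \<open>y / pi\<close>, leaving the integral \<open>pi\<close> of the
  weight.\<close>

lemma poisson1_convolution_bound:
  assumes "y > 0"
  shows "(\<integral>\<^sup>+x. ennreal (poisson1 y (x - t) * (1 / (1 + x\<^sup>2))) \<partial>lborel)
    \<le> ennreal ((2 + 2 * y) * (1 / (1 + t\<^sup>2)))"
proof -
  have pw: "poisson1 y (x - t) * (1 / (1 + x\<^sup>2))
      \<le> 1 / (1 + t\<^sup>2) * (2 * poisson1 y (x - t) + 2 * y / pi * (1 / (1 + x\<^sup>2)))" for x
  proof -
    \<comment> \<open>The right side of the next inequality exceeds the left by exactly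
      \<open>1 + (2 * x - t)^2\<close>.\<close>
    have "(2 * x - t)\<^sup>2 \<ge> 0" by simp
    then have t: "1 + t\<^sup>2 \<le> 2 * (1 + x\<^sup>2) + 2 * (x - t)\<^sup>2"
      by (simp add: power2_eq_square algebra_simps)
    have p: "poisson1 y (x - t) * (x - t)\<^sup>2 \<le> y / pi"
    proof -
      have "(x - t)\<^sup>2 + y\<^sup>2 > 0" using assms by (simp add: add_nonneg_pos)
      then show ?thesis
        using assms by (simp add: poisson1_def divide_simps mult_left_mono)
    qed
    have "poisson1 y (x - t) * (1 + t\<^sup>2) \<le> poisson1 y (x - t) * (2 * (1 + x\<^sup>2) + 2 * (x - t)\<^sup>2)"
      using t assms by (intro mult_left_mono poisson1_nonneg) auto
    also have "\<dots> \<le> 2 * poisson1 y (x - t) * (1 + x\<^sup>2) + 2 * y / pi"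
      using mult_left_mono[OF p, of 2] by (simp add: algebra_simps)
    finally have "poisson1 y (x - t) * (1 + t\<^sup>2) \<le> 2 * poisson1 y (x - t) * (1 + x\<^sup>2) + 2 * y / pi" .
    moreover have "1 + x\<^sup>2 > 0" "1 + t\<^sup>2 > 0"
      by (simp_all add: add_pos_nonneg)
    ultimately show ?thesis
      by (simp add: divide_simps) (simp add: algebra_simps)
  qed
  have lin: "(\<integral>\<^sup>+x. a * (b * f x + c * g x) \<partial>lborel)
      = a * (b * (\<integral>\<^sup>+x. f x \<partial>lborel) + c * (\<integral>\<^sup>+x. g x \<partial>lborel))"
    if [measurable]: "f \<in> borel_measurable borel" "g \<in> borel_measurable borel"
    for a b c and f g :: "real \<Rightarrow> ennreal"
    by (simp add: nn_integral_cmult nn_integral_add)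
  have "(\<integral>\<^sup>+x. ennreal (poisson1 y (x - t) * (1 / (1 + x\<^sup>2))) \<partial>lborel)
      \<le> (\<integral>\<^sup>+x. ennreal (1 / (1 + t\<^sup>2)) * (ennreal 2 * ennreal (poisson1 y (x - t))
          + ennreal (2 * y / pi) * ennreal (1 / (1 + x\<^sup>2))) \<partial>lborel)"
  proof (intro nn_integral_mono)
    fix x
    show "ennreal (poisson1 y (x - t) * (1 / (1 + x\<^sup>2)))
      \<le> ennreal (1 / (1 + t\<^sup>2)) * (ennreal 2 * ennreal (poisson1 y (x - t))
          + ennreal (2 * y / pi) * ennreal (1 / (1 + x\<^sup>2)))"
      using pw[of x] assms poisson1_nonneg[of y "x - t"]
      by (simp flip: ennreal_mult ennreal_plus ennreal_numeral add: ennreal_leI del: ennreal_numeral)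
  qed
  also have "\<dots> = ennreal (1 / (1 + t\<^sup>2)) *
      (ennreal 2 * (\<integral>\<^sup>+x. ennreal (poisson1 y (x - t)) \<partial>lborel)
        + ennreal (2 * y / pi) * (\<integral>\<^sup>+x. ennreal (1 / (1 + x\<^sup>2)) \<partial>lborel))"
    by (rule lin) measurable
  also have "\<dots> = ennreal (1 / (1 + t\<^sup>2)) * (ennreal 2 * 1 + ennreal (2 * y / pi) * ennreal pi)"
    by (simp only: nn_integral_poisson1[OF assms] nn_integral_inverse_1_plus_square)
  also have "\<dots> = ennreal (1 / (1 + t\<^sup>2)) * ennreal (2 + 2 * y)"
  proof -
    have "ennreal (2 * y / pi) * ennreal pi = ennreal (2 * y)"
      using assms by (subst ennreal_mult[symmetric]) auto
    moreover have "ennreal 2 + ennreal (2 * y) = ennreal (2 + 2 * y)"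
      using assms by (subst ennreal_plus) auto
    ultimately show ?thesis
      by (simp only: mult_1_right)
  qed
  also have "\<dots> = ennreal ((2 + 2 * y) * (1 / (1 + t\<^sup>2)))"
    using assms by (subst ennreal_mult[symmetric]) (auto simp: mult.commute)
  finally show ?thesis .
qed

section \<open>Products over the coordinates and their expansion\<close>

lemma nn_integral_lborel_vec_prod:
  fixes f :: "'n::finite \<Rightarrow> real \<Rightarrow> ennreal"
  assumes [measurable]: "\<And>l. f l \<in> borel_measurable borel"
  shows "(\<integral>\<^sup>+x. (\<Prod>l\<in>UNIV. f l (x $ l)) \<partial>(lborel :: (real ^ 'n) measure))
    = (\<Prod>l\<in>UNIV. \<integral>\<^sup>+x. f l x \<partial>lborel)"
proof -
  have ax: "bij_betw (\<lambda>l. axis l (1::real)) (UNIV :: 'n set) Basis"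
    by (auto simp: bij_betw_def inj_on_def axis_eq_axis Basis_vec_def)
  \<comment> \<open>\<open>nn_integral_lborel_prod\<close> indexes its factors by
    \<open>Basis\<close>; \<open>F\<close> carries the family \<open>f\<close> over along the
    bijection sending \<open>l\<close> to \<open>axis l 1\<close>.\<close>
  define F where "F b = f (inv_into UNIV (\<lambda>l::'n. axis l (1::real)) b)" for b :: "real ^ 'n"
  have F: "F (axis l 1) = f l" for l
    using bij_betw_inv_into_left[OF ax, of l] by (simp add: F_def)
  have "(\<integral>\<^sup>+x. (\<Prod>b\<in>Basis. F b (x \<bullet> b)) \<partial>(lborel :: (real ^ 'n) measure))
      = (\<Prod>b\<in>Basis. \<integral>\<^sup>+x. F b x \<partial>lborel)"
    by (intro nn_integral_lborel_prod) (auto simp: F_def)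
  then show ?thesis
    by (simp add: F inner_axis flip: prod.reindex_bij_betw[OF ax])
qed

text \<open>On expanding the product, \<open>B\<close> collects the factors that contribute
  \<open>- b l\<close>. The result is written with \<open>if\<close> so that it matches the
  coordinates of \<open>Psi B\<close>.\<close>

lemma prod_diff_subsets:
  fixes a b :: "'n::finite \<Rightarrow> 'a::comm_ring_1"
  shows "(\<Prod>l\<in>UNIV. a l - b l) = (\<Sum>B\<in>UNIV. (-1) ^ card B * (\<Prod>l\<in>UNIV. if l \<in> B then b l else a l))"
proof -
  have "(\<Prod>l\<in>UNIV. a l - b l) = (\<Prod>l\<in>UNIV. - b l + a l)"
    by simp
  also have "\<dots> = (\<Sum>B\<in>UNIV. (\<Prod>l\<in>B. - b l) * (\<Prod>l\<in>UNIV - B. a l))"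
    by (subst prod_add) simp_all
  also have "\<dots> = (\<Sum>B\<in>UNIV. (-1) ^ card B * (\<Prod>l\<in>UNIV. if l \<in> B then b l else a l))"
    by (intro sum.cong refl)
       (simp add: prod_uminus prod.If_cases Compl_eq_Diff_UNIV mult.assoc)
  finally show ?thesis .
qed

text \<open>With \<open>a = b = 1\<close> the product in \<open>prod_diff_subsets\<close> has only
  zero factors. It vanishes because the index type is nonempty; this is where n \<ge> 1
  enters.\<close>

lemma sum_minus_one_card_subsets:
  "(\<Sum>B\<in>(UNIV :: 'n::finite set set). (-1) ^ card B) = (0 :: 'a::comm_ring_1)"
  using prod_diff_subsets[of "\<lambda>_::'n. 1 :: 'a" "\<lambda>_. 1"] by (simp add: power_0_left)

section \<open>The Poisson kernel of a product of half-planes\<close>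

definition poisson :: "real ^ 'n \<Rightarrow> real ^ 'n \<Rightarrow> real" where
  "poisson y x = (\<Prod>l\<in>UNIV. poisson1 (y $ l) (x $ l))"

text \<open>The weight in the growth condition on the measure and also the decay rate required of
  the test function, so that one function serves as majorant on both sides.\<close>

definition decay :: "real ^ 'n \<Rightarrow> real" where
  "decay t = (\<Prod>l\<in>UNIV. 1 / (1 + (t $ l)\<^sup>2))"

lemma decay_pos: "0 < decay t"
  by (auto simp: decay_def intro!: prod_pos divide_pos_pos add_pos_nonneg)

lemma decay_nonneg: "0 \<le> decay t"
  using decay_pos[of t] by simp

lemma decay_le_1: "decay t \<le> 1"
proof -
  have "1 / (1 + s\<^sup>2) \<le> 1" for s :: real
    by (subst divide_le_eq_1_pos) (simp_all add: add_pos_nonneg)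
  then show ?thesis
    by (auto simp: decay_def intro!: prod_le_1)
qed

lemma borel_measurable_decay [measurable]: "decay \<in> borel_measurable borel"
  unfolding decay_def by measurable

lemma borel_measurable_poisson [measurable]: "poisson y \<in> borel_measurable borel"
  unfolding poisson_def by measurable

lemma poisson_nonneg: "(\<And>l. 0 < y $ l) \<Longrightarrow> 0 \<le> poisson y x"
  by (auto simp: poisson_def less_imp_le intro!: prod_nonneg poisson1_nonneg)

lemma nn_integral_poisson:
  fixes y t :: "real ^ 'n"
  assumes "\<And>l. 0 < y $ l"
  shows "(\<integral>\<^sup>+x. ennreal (poisson y (x - t)) \<partial>lborel) = 1"
proof -
  have "(\<integral>\<^sup>+x. ennreal (poisson y (x - t)) \<partial>lborel)
      = (\<integral>\<^sup>+x. (\<Prod>l\<in>UNIV. ennreal (poisson1 (y $ l) (x $ l - t $ l))) \<partial>lborel)"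
    using assms by (simp add: poisson_def prod_ennreal poisson1_nonneg less_imp_le)
  also have "\<dots> = 1"
    using assms by (subst nn_integral_lborel_vec_prod) (simp_all add: nn_integral_poisson1)
  finally show ?thesis .
qed

lemma poisson_convolution_bound:
  fixes y t :: "real ^ 'n"
  assumes "\<And>l. 0 < y $ l"
  shows "(\<integral>\<^sup>+x. ennreal (poisson y (x - t) * decay x) \<partial>lborel)
    \<le> ennreal ((\<Prod>l\<in>UNIV. 2 + 2 * y $ l) * decay t)"
proof -
  have y: "0 \<le> y $ l" for l
    using assms[of l] by simp
  have "(\<integral>\<^sup>+x. ennreal (poisson y (x - t) * decay x) \<partial>lborel)
      = (\<integral>\<^sup>+x. (\<Prod>l\<in>UNIV. ennreal (poisson1 (y $ l) (x $ l - t $ l) * (1 / (1 + (x $ l)\<^sup>2)))) \<partial>lborel)"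
  proof (intro nn_integral_cong)
    fix x
    have "poisson y (x - t) * decay x = (\<Prod>l\<in>UNIV. poisson1 (y $ l) (x $ l - t $ l) * (1 / (1 + (x $ l)\<^sup>2)))"
      by (simp only: poisson_def decay_def prod.distrib vector_minus_component)
    then show "ennreal (poisson y (x - t) * decay x)
        = (\<Prod>l\<in>UNIV. ennreal (poisson1 (y $ l) (x $ l - t $ l) * (1 / (1 + (x $ l)\<^sup>2))))"
      by (simp add: prod_ennreal poisson1_nonneg y)
  qed
  also have "\<dots> = (\<Prod>l\<in>UNIV. \<integral>\<^sup>+x. ennreal (poisson1 (y $ l) (x - t $ l) * (1 / (1 + x\<^sup>2))) \<partial>lborel)"
    by (subst nn_integral_lborel_vec_prod[where f="\<lambda>l x. ennreal (poisson1 (y $ l) (x - t $ l) * (1 / (1 + x\<^sup>2)))"]) auto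
  also have "\<dots> \<le> (\<Prod>l\<in>UNIV. ennreal ((2 + 2 * y $ l) * (1 / (1 + (t $ l)\<^sup>2))))"
    by (intro prod_mono_ennreal poisson1_convolution_bound assms)
  also have "\<dots> = ennreal ((\<Prod>l\<in>UNIV. 2 + 2 * y $ l) * decay t)"
    using y by (subst prod_ennreal) (simp_all only: decay_def prod.distrib, simp)
  finally show ?thesis .
qed

section \<open>Rescaling and the approximate identity\<close>

lemma lborel_vec_scale:
  fixes y t :: "real ^ 'n"
  assumes "\<And>l. 0 < y $ l"
  shows "lborel = density (distr lborel borel (\<lambda>u. t + (\<chi> l. y $ l * u $ l))) (\<lambda>_. ennreal (\<Prod>l\<in>UNIV. y $ l))"
proof -
  have ax: "bij_betw (\<lambda>l. axis l (1::real)) (UNIV :: 'n set) Basis"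
    by (auto simp: bij_betw_def inj_on_def axis_eq_axis Basis_vec_def)
  \<comment> \<open>\<open>lborel_affine_euclidean\<close> speaks of \<open>Basis\<close>;
    \<open>scale\<close> and \<open>det\<close> translate its map and its Jacobian into
    coordinates.\<close>
  have scale: "(\<Sum>j\<in>Basis. ((y \<bullet> j) * (u \<bullet> j)) *\<^sub>R j) = (\<chi> l. y $ l * u $ l)" for u
  proof (subst euclidean_eq_iff, intro ballI)
    fix b :: "real ^ 'n" assume b: "b \<in> Basis"
    then have "(\<Sum>j\<in>Basis. ((y \<bullet> j) * (u \<bullet> j)) *\<^sub>R j) \<bullet> b = (y \<bullet> b) * (u \<bullet> b)"
      by simp
    also from b have "\<dots> = (\<chi> l. y $ l * u $ l) \<bullet> b"
      by (auto simp: Basis_vec_def inner_axis)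
    finally show "(\<Sum>j\<in>Basis. ((y \<bullet> j) * (u \<bullet> j)) *\<^sub>R j) \<bullet> b = (\<chi> l. y $ l * u $ l) \<bullet> b" .
  qed
  have det: "(\<Prod>j\<in>Basis. \<bar>y \<bullet> j\<bar>) = (\<Prod>l\<in>UNIV. y $ l)"
    using assms by (simp add: inner_axis abs_of_pos flip: prod.reindex_bij_betw[OF ax])
  have "y \<bullet> j \<noteq> 0" if "j \<in> Basis" for j
    using that assms by (auto simp: Basis_vec_def inner_axis less_le)
  then have "lborel = density (distr lborel borel (\<lambda>u. t + (\<Sum>j\<in>Basis. ((y \<bullet> j) * (u \<bullet> j)) *\<^sub>R j)))
      (\<lambda>_. ennreal (\<Prod>j\<in>Basis. \<bar>y \<bullet> j\<bar>))"
    by (rule lborel_affine_euclidean)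
  then show ?thesis
    unfolding scale det .
qed

text \<open>Moves the scale from the kernel into the argument of \<open>f\<close>. The kernel is
  then fixed at scale \<open>1\<close>, the vector of ones, and can serve in a majorant that does
  not depend on \<open>y\<close>.\<close>

lemma integral_poisson_scale:
  fixes y t :: "real ^ 'n" and f :: "real ^ 'n \<Rightarrow> real"
  assumes "\<And>l. 0 < y $ l" and [measurable]: "f \<in> borel_measurable borel"
  shows "(\<integral>x. f x * poisson y (x - t) \<partial>lborel)
    = (\<integral>u. f (t + (\<chi> l. y $ l * u $ l)) * poisson 1 u \<partial>lborel)"
proof -
  let ?T = "\<lambda>u. t + (\<chi> l. y $ l * u $ l)"
  have T [measurable]: "?T \<in> borel_measurable borel"
    by (intro borel_measurable_continuous_onI continuous_intros)
  have p: "(\<Prod>l\<in>UNIV. y $ l) * poisson y (\<chi> l. y $ l * u $ l) = poisson 1 u" for u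
  proof -
    have "y $ l * poisson1 (y $ l) (y $ l * u $ l) = poisson1 1 (u $ l)" for l
    proof -
      have "(y $ l * u $ l)\<^sup>2 + (y $ l)\<^sup>2 = (y $ l)\<^sup>2 * ((u $ l)\<^sup>2 + 1)"
        by (simp add: algebra_simps)
      then show ?thesis
        using assms(1)[of l] by (simp add: poisson1_def power2_eq_square)
    qed
    then show ?thesis
      by (simp add: poisson_def flip: prod.distrib)
  qed
  have "(\<integral>x. f x * poisson y (x - t) \<partial>lborel)
      = (\<integral>u. (\<Prod>l\<in>UNIV. y $ l) * (f (?T u) * poisson y (\<chi> l. y $ l * u $ l)) \<partial>lborel)"
    using assms(1) by (subst lborel_vec_scale[of y t])
      (auto simp: integral_density integral_distr prod_nonneg less_imp_le)
  also have "\<dots> = (\<integral>u. f (?T u) * poisson 1 u \<partial>lborel)"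
    by (intro Bochner_Integration.integral_cong refl) (simp flip: p)
  finally show ?thesis .
qed

lemma integrable_poisson:
  fixes y t :: "real ^ 'n"
  assumes "\<And>l. 0 < y $ l"
  shows "integrable lborel (\<lambda>x. poisson y (x - t))"
  using nn_integral_poisson[OF assms] by (intro integrableI_nonneg) (auto simp: poisson_nonneg assms)

text \<open>After rescaling, the argument of \<open>f\<close> tends to \<open>t\<close> for each
  fixed \<open>u\<close>, so continuity gives pointwise convergence, dominated by
  \<open>D * poisson 1 u\<close>. Mass one of the kernel identifies the limit. The coordinates of
  \<open>Y k\<close> may shrink at unrelated rates.\<close>

lemma tendsto_poisson_integral:
  fixes t :: "real ^ 'n" and f :: "real ^ 'n \<Rightarrow> real"
  assumes pos: "\<And>k l. 0 < Y k $ l" and Y: "Y \<longlonglongrightarrow> 0"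
    and f: "continuous_on UNIV f" and bd: "\<And>x. \<bar>f x\<bar> \<le> D"
  shows "(\<lambda>k. \<integral>x. f x * poisson (Y k) (x - t) \<partial>lborel) \<longlonglongrightarrow> f t"
proof -
  have [measurable]: "f \<in> borel_measurable borel"
    using f by (rule borel_measurable_continuous_onI)
  have [measurable]: "(\<lambda>u. t + (\<chi> l. Y k $ l * u $ l)) \<in> borel_measurable borel" for k
    by (intro borel_measurable_continuous_onI continuous_intros)
  have int: "integrable lborel (poisson (1 :: real ^ 'n))"
    using integrable_poisson[of "1 :: real ^ 'n" 0] by simp
  have p: "0 \<le> poisson (1 :: real ^ 'n) u" for u
    by (simp add: poisson_nonneg)
  have "(\<integral>u. poisson (1 :: real ^ 'n) u \<partial>lborel) = 1"
    using nn_integral_poisson[of "1 :: real ^ 'n" 0] p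
    by (subst integral_eq_nn_integral) auto
  then have ft: "(\<integral>u. f t * poisson (1 :: real ^ 'n) u \<partial>lborel) = f t"
    by simp
  have "(\<lambda>k. \<integral>u. f (t + (\<chi> l. Y k $ l * u $ l)) * poisson 1 u \<partial>lborel)
      \<longlonglongrightarrow> (\<integral>u. f t * poisson (1 :: real ^ 'n) u \<partial>lborel)"
  proof (rule integral_dominated_convergence[where w="\<lambda>u. D * poisson 1 u"])
    show "AE u in lborel. (\<lambda>k. f (t + (\<chi> l. Y k $ l * u $ l)) * poisson 1 u)
        \<longlonglongrightarrow> f t * poisson 1 u"
    proof (intro AE_I2 tendsto_mult tendsto_const)
      fix u :: "real ^ 'n"
      have "(\<lambda>k. t + (\<chi> l. Y k $ l * u $ l)) \<longlonglongrightarrow> t + (\<chi> l. 0 * u $ l)"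
        by (intro tendsto_intros) (use tendsto_vec_nth[OF Y] in simp)
      then have "(\<lambda>k. t + (\<chi> l. Y k $ l * u $ l)) \<longlonglongrightarrow> t"
        by (simp add: vec_eq_iff flip: zero_vec_def)
      then show "(\<lambda>k. f (t + (\<chi> l. Y k $ l * u $ l))) \<longlonglongrightarrow> f t"
        using f by (intro continuous_on_tendsto_compose[OF f]) auto
    qed
    show "AE u in lborel. norm (f (t + (\<chi> l. Y k $ l * u $ l)) * poisson 1 u) \<le> D * poisson 1 u" for k
      by (intro AE_I2) (auto simp: abs_mult abs_of_nonneg[OF p] intro!: mult_right_mono bd p)
  qed (use int in auto)
  then show ?thesis
    unfolding ft by (simp add: integral_poisson_scale pos)
qed

section \<open>Sigma-finiteness and integrability of the Cauchy kernel\<close>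

lemma sigma_finite_measure_nn_integral_pos:
  assumes [measurable]: "h \<in> borel_measurable M"
    and pos: "\<And>x. x \<in> space M \<Longrightarrow> 0 < h x" and fin: "(\<integral>\<^sup>+x. ennreal (h x) \<partial>M) < \<infinity>"
  shows "sigma_finite_measure M"
proof
  \<comment> \<open>These are the sets where \<open>h\<close> is at least \<open>1 / k\<close>: of
    finite measure by Markov's inequality, and exhausting the space because \<open>h\<close> is
    positive. For \<open>h = decay\<close> this yields the sigma-finiteness of the measure on which
    Fubini relies.\<close>
  let ?A = "\<lambda>k. {x \<in> space M. 1 \<le> of_nat k * ennreal (h x)}"
  have "emeasure M (?A k) \<noteq> \<infinity>" for k
  proof -
    have "emeasure M (?A k) \<le> of_nat k * (\<integral>\<^sup>+x. ennreal (h x) * indicator (space M) x \<partial>M)"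
      by (intro nn_integral_Markov_inequality) auto
    also have "\<dots> = of_nat k * (\<integral>\<^sup>+x. ennreal (h x) \<partial>M)"
      by (intro arg_cong2[where f="(*)"] refl nn_integral_cong) simp
    also have "\<dots> < \<infinity>"
      using fin by (simp add: ennreal_mult_less_top of_nat_less_top)
    finally show ?thesis by simp
  qed
  moreover have "\<exists>k. 1 \<le> of_nat k * ennreal (h x)" if "x \<in> space M" for x
  proof -
    obtain k where "1 / h x \<le> real k"
      using real_arch_simple by blast
    then have "1 \<le> real k * h x"
      using pos[OF that] by (simp add: divide_simps)
    then have "1 \<le> of_nat k * ennreal (h x)"
      using pos[OF that] by (simp add: ennreal_of_nat_eq_real_of_nat flip: ennreal_mult)
    then show ?thesis ..
  qed
  ultimately show "\<exists>A. countable A \<and> A \<subseteq> sets M \<and> \<Union> A = space M \<and> (\<forall>a\<in>A. emeasure M a \<noteq> \<infinity>)"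
    by (intro exI[of _ "range ?A"]) auto
qed

text \<open>Each fraction alone decays only like \<open>1 / t\<close>, but the difference equals
  \<open>(z + \<i>) / ((t - z) * (t + \<i>))\<close>. Since \<open>t + \<i>\<close> has squared
  modulus \<open>1 + t^2\<close>, it remains to bound the modulus of \<open>t + \<i>\<close> by a
  multiple of that of \<open>t - z\<close>, using the triangle inequality and the distance of
  \<open>z\<close> from the real line.\<close>

lemma cauchy_factor_bound:
  assumes "z \<notin> \<real>"
  shows "norm (1 / (complex_of_real t - z) - 1 / (complex_of_real t + \<i>))
    \<le> norm (z + \<i>) * (1 + norm (z + \<i>) / \<bar>Im z\<bar>) * (1 / (1 + t\<^sup>2))"
proof -
  have Im: "Im z \<noteq> 0"
    using assms by (auto simp: complex_is_Real_iff)
  have nz: "complex_of_real t - z \<noteq> 0" "complex_of_real t + \<i> \<noteq> 0"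
    using Im by (auto simp: complex_eq_iff)
  have n2: "norm (complex_of_real t + \<i>) * norm (complex_of_real t + \<i>) = 1 + t\<^sup>2"
    by (simp add: cmod_def add.commute)
  have "\<bar>Im z\<bar> \<le> norm (complex_of_real t - z)"
    using abs_Im_le_cmod[of "complex_of_real t - z"] by simp
  then have "norm (z + \<i>) \<le> norm (complex_of_real t - z) * (norm (z + \<i>) / \<bar>Im z\<bar>)"
    using Im mult_right_mono[of "\<bar>Im z\<bar>" "norm (complex_of_real t - z)" "norm (z + \<i>)"]
    by (simp add: field_simps)
  moreover have "norm (complex_of_real t + \<i>) \<le> norm (complex_of_real t - z) + norm (z + \<i>)"
    using norm_triangle_ineq[of "complex_of_real t - z" "z + \<i>"] by simp
  ultimately have "norm (complex_of_real t + \<i>)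
      \<le> norm (complex_of_real t - z) * (1 + norm (z + \<i>) / \<bar>Im z\<bar>)"
    by (simp add: algebra_simps)
  then have "1 / norm (complex_of_real t - z)
      \<le> (1 + norm (z + \<i>) / \<bar>Im z\<bar>) / norm (complex_of_real t + \<i>)"
    using nz by (simp add: field_simps)
  then have "norm (z + \<i>) * (1 / norm (complex_of_real t - z)) / norm (complex_of_real t + \<i>)
      \<le> norm (z + \<i>) * ((1 + norm (z + \<i>) / \<bar>Im z\<bar>) / norm (complex_of_real t + \<i>)) / norm (complex_of_real t + \<i>)"
    by (intro divide_right_mono mult_left_mono) auto
  also have "\<dots> = norm (z + \<i>) * (1 + norm (z + \<i>) / \<bar>Im z\<bar>) * (1 / (1 + t\<^sup>2))"
    by (simp flip: n2)
  also have "norm (z + \<i>) * (1 / norm (complex_of_real t - z)) / norm (complex_of_real t + \<i>)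
      = norm (1 / (complex_of_real t - z) - 1 / (complex_of_real t + \<i>))"
  proof -
    have "1 / (complex_of_real t - z) - 1 / (complex_of_real t + \<i>)
        = (z + \<i>) / ((complex_of_real t - z) * (complex_of_real t + \<i>))"
      using nz by (simp add: field_simps)
    then show ?thesis
      by (simp add: norm_divide norm_mult)
  qed
  finally show ?thesis .
qed

lemma prod_cauchy_factor_bound:
  fixes z :: "complex ^ 'n"
  assumes "z \<in> nonreal_vecs"
  obtains C where "\<And>t. norm (\<Prod>l\<in>UNIV. 1 / (complex_of_real (t $ l) - z $ l) - 1 / (complex_of_real (t $ l) + \<i>)) \<le> C * decay t"
proof
  let ?c = "\<lambda>l. norm (z $ l + \<i>) * (1 + norm (z $ l + \<i>) / \<bar>Im (z $ l)\<bar>)"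
  show "norm (\<Prod>l\<in>UNIV. 1 / (complex_of_real (t $ l) - z $ l) - 1 / (complex_of_real (t $ l) + \<i>))
      \<le> (\<Prod>l\<in>UNIV. ?c l) * decay t" for t
    unfolding decay_def prod_norm[symmetric] prod.distrib[symmetric]
    using assms by (intro prod_mono conjI norm_ge_zero cauchy_factor_bound) (simp add: nonreal_vecs_def)
qed

lemma integrable_Kn:
  fixes \<mu> :: "(real ^ 'n) measure"
  assumes sets [measurable_cong]: "sets \<mu> = sets borel"
    and int: "integrable \<mu> decay" and z: "z \<in> nonreal_vecs"
  shows "integrable \<mu> (Kn z)"
proof -
  have i: "integrable \<mu> (\<lambda>t. \<Prod>l\<in>UNIV. 1 / (complex_of_real (t $ l) - w $ l) - 1 / (complex_of_real (t $ l) + \<i>))"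
    if w: "w \<in> nonreal_vecs" for w :: "complex ^ 'n"
  proof -
    obtain C where C: "\<And>t. norm (\<Prod>l\<in>UNIV. 1 / (complex_of_real (t $ l) - w $ l) - 1 / (complex_of_real (t $ l) + \<i>)) \<le> C * decay t"
      using prod_cauchy_factor_bound[OF w] by metis
    show ?thesis
      by (rule Bochner_Integration.integrable_bound[of _ "\<lambda>t. C * decay t"])
         (use int in \<open>auto intro!: AE_I2 order_trans[OF C]\<close>)
  qed
  \<comment> \<open>The second product in \<open>Kn\<close> is the first one evaluated at the vector
    with all entries \<open>\<i>\<close>, so the same bound covers it.\<close>
  have "(\<chi> l. \<i>) \<in> (nonreal_vecs :: (complex ^ 'n) set)"
    by (simp add: nonreal_vecs_def complex_is_Real_iff)
  from i[OF this] i[OF z] show ?thesis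
    unfolding Kn_def by simp
qed

section \<open>From the alternating sum to the Poisson kernel\<close>

lemma sum_Kn_Psi:
  fixes x y t :: "real ^ 'n"
  assumes "\<And>l. 0 < y $ l"
  shows "(\<Sum>B\<in>UNIV. (-1) ^ card B * Kn (Psi B (complex_vec x y) (complex_vec x y)) t)
    = 2 * \<i> * complex_of_real (pi ^ CARD('n) * poisson y (x - t))"
proof -
  let ?z = "complex_vec x y"
  let ?e = "\<lambda>l. 1 / (complex_of_real (t $ l) + \<i>)"
  let ?a = "\<lambda>l. 1 / (complex_of_real (t $ l) - ?z $ l) - ?e l"
  let ?b = "\<lambda>l. 1 / (complex_of_real (t $ l) - cnj (?z $ l)) - ?e l"
  \<comment> \<open>The part of \<open>Kn\<close> independent of \<open>z\<close>. It is the same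
    for every \<open>B\<close>, hence gets multiplied by the alternating sum of signs, which is
    zero.\<close>
  define c where "c = \<i> * (1 / (2 * \<i>) ^ CARD('n) * (\<Prod>l\<in>(UNIV :: 'n set). 1 / (complex_of_real (t $ l) - \<i>) - ?e l))"
  have K: "Kn (Psi B ?z ?z) t
      = \<i> * (2 / (2 * \<i>) ^ CARD('n)) * (\<Prod>l\<in>UNIV. if l \<in> B then ?b l else ?a l) - c" for B
    unfolding Kn_def c_def
    by (simp add: Psi_def right_diff_distrib if_distrib[of "\<lambda>w. 1 / (_ - w) - _"] cong: if_cong)
  \<comment> \<open>The terms \<open>?e l\<close> cancel, leaving
    \<open>(z - cnj z) / ((t - z) * (t - cnj z))\<close> with \<open>z = ?z $ l\<close>, that is
    \<open>2 * \<i> * y / ((x - t)^2 + y^2)\<close> in the coordinate \<open>l\<close>.\<close>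
  have ab: "?a l - ?b l = 2 * \<i> * complex_of_real (pi * poisson1 (y $ l) ((x - t) $ l))" for l
  proof -
    have "(x $ l - t $ l)\<^sup>2 + (y $ l)\<^sup>2 > 0"
      using assms[of l] by (simp add: add_nonneg_pos)
    moreover have "complex_of_real (t $ l) - ?z $ l \<noteq> 0" "complex_of_real (t $ l) - cnj (?z $ l) \<noteq> 0"
      using assms[of l] by (auto simp: complex_vec_def complex_eq_iff)
    moreover have "(complex_of_real (t $ l) - ?z $ l) * (complex_of_real (t $ l) - cnj (?z $ l))
        = complex_of_real ((x $ l - t $ l)\<^sup>2 + (y $ l)\<^sup>2)"
      by (simp add: complex_vec_def complex_eq_iff power2_eq_square algebra_simps)
    moreover have "?z $ l - cnj (?z $ l) = 2 * \<i> * complex_of_real (y $ l)"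
      by (simp add: complex_vec_def complex_eq_iff)
    ultimately show ?thesis
      by (simp add: poisson1_def diff_frac_eq)
  qed
  have "(\<Sum>B\<in>UNIV. (-1) ^ card B * Kn (Psi B ?z ?z) t)
      = \<i> * (2 / (2 * \<i>) ^ CARD('n)) * (\<Sum>B\<in>UNIV. (-1) ^ card B * (\<Prod>l\<in>UNIV. if l \<in> B then ?b l else ?a l))
        - (\<Sum>B\<in>(UNIV :: 'n set set). (-1) ^ card B) * c"
    by (simp only: K right_diff_distrib sum_subtractf sum_distrib_left sum_distrib_right mult_ac)
  also have "\<dots> = \<i> * (2 / (2 * \<i>) ^ CARD('n)) * (\<Prod>l\<in>UNIV. ?a l - ?b l)"
    by (simp only: prod_diff_subsets sum_minus_one_card_subsets) simp
  \<comment> \<open>The factors \<open>2 * \<i>\<close> from \<open>ab\<close>, one per coordinate,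
    cancel the power in the denominator.\<close>
  also have "\<dots> = 2 * \<i> * complex_of_real (pi ^ CARD('n) * poisson y (x - t))"
    by (simp only: ab) (simp add: prod.distrib poisson_def)
  finally show ?thesis .
qed

lemma Psi_complex_vec_nonreal:
  assumes "\<And>l. 0 < y $ l"
  shows "Psi B (complex_vec x y) (complex_vec x y) \<in> nonreal_vecs"
  using assms by (auto simp: nonreal_vecs_def Psi_def complex_vec_def complex_is_Real_iff less_le)

lemma Cauchy_type_function_integrable_decay:
  assumes "Cauchy_type_function g \<mu>"
  shows "integrable \<mu> decay"
proof -
  have [measurable_cong]: "sets \<mu> = sets borel"
    using assms by (simp add: Cauchy_type_function_def)
  show ?thesis
    using assms decay_pos[THEN less_imp_le]
    by (intro integrableI_nonneg) (auto simp: Cauchy_type_function_def decay_def[abs_def])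
qed

text \<open>Integrability of each \<open>Kn\<close> lets the finite sum pass under the integral,
  where \<open>sum_Kn_Psi\<close> applies; its power of \<open>pi\<close> cancels the normalisation
  of \<open>g\<close>. The remaining \<open>2 * \<i>\<close> is what the prefactor in the theorem
  removes.\<close>

lemma sum_Cauchy_type_Psi:
  fixes g :: "complex ^ 'n \<Rightarrow> complex"
  assumes g: "Cauchy_type_function g \<mu>" and y: "\<And>l. 0 < y $ l"
  shows "(\<Sum>B\<in>UNIV. (-1) ^ card B * g (Psi B (complex_vec x y) (complex_vec x y)))
    = 2 * \<i> * complex_of_real (\<integral>t. poisson y (x - t) \<partial>\<mu>)"
proof -
  let ?P = "\<lambda>B. Psi B (complex_vec x y) (complex_vec x y)"
  have int: "integrable \<mu> (Kn (?P B))" for B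
    using g by (intro integrable_Kn Cauchy_type_function_integrable_decay[OF g] Psi_complex_vec_nonreal y)
      (simp_all add: Cauchy_type_function_def)
  have "(\<Sum>B\<in>UNIV. (-1) ^ card B * g (?P B))
      = 1 / complex_of_real pi ^ CARD('n) * (\<Sum>B\<in>UNIV. (-1) ^ card B * (\<integral>t. Kn (?P B) t \<partial>\<mu>))"
    using g Psi_complex_vec_nonreal[OF y]
    by (simp add: Cauchy_type_function_def sum_distrib_left mult_ac)
  also have "(\<Sum>B\<in>UNIV. (-1) ^ card B * (\<integral>t. Kn (?P B) t \<partial>\<mu>))
      = (\<integral>t. (\<Sum>B\<in>UNIV. (-1) ^ card B * Kn (?P B) t) \<partial>\<mu>)"
    using int by (simp add: Bochner_Integration.integral_sum)
  also have "\<dots> = 2 * \<i> * complex_of_real (pi ^ CARD('n) * (\<integral>t. poisson y (x - t) \<partial>\<mu>))"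
    by (simp only: sum_Kn_Psi[OF y] integral_mult_right_zero integral_complex_of_real)
  finally show ?thesis
    by simp
qed

section \<open>Fubini and the passage to the limit\<close>

lemma norm_poisson_integral_le:
  fixes f :: "real ^ 'n \<Rightarrow> real"
  assumes [measurable]: "f \<in> borel_measurable borel"
    and bd: "\<And>x. \<bar>f x\<bar> \<le> D * decay x" and D: "0 \<le> D" and y: "\<And>l. 0 < y $ l"
  shows "(\<integral>\<^sup>+x. ennreal (norm (f x * poisson y (x - t))) \<partial>lborel)
    \<le> ennreal (D * (\<Prod>l\<in>UNIV. 2 + 2 * y $ l) * decay t)"
proof -
  have "(\<integral>\<^sup>+x. ennreal (norm (f x * poisson y (x - t))) \<partial>lborel)
      \<le> (\<integral>\<^sup>+x. ennreal D * ennreal (poisson y (x - t) * decay x) \<partial>lborel)"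
  proof (intro nn_integral_mono)
    fix x
    have "norm (f x * poisson y (x - t)) \<le> D * (poisson y (x - t) * decay x)"
      using mult_right_mono[OF bd[of x] poisson_nonneg[OF y, of "x - t"]] poisson_nonneg[OF y, of "x - t"]
      by (simp add: abs_mult mult_ac)
    then show "ennreal (norm (f x * poisson y (x - t))) \<le> ennreal D * ennreal (poisson y (x - t) * decay x)"
      using D by (simp add: ennreal_leI flip: ennreal_mult')
  qed
  also have "\<dots> = ennreal D * (\<integral>\<^sup>+x. ennreal (poisson y (x - t) * decay x) \<partial>lborel)"
    by (intro nn_integral_cmult) measurable
  also have "\<dots> \<le> ennreal D * ennreal ((\<Prod>l\<in>UNIV. 2 + 2 * y $ l) * decay t)"
    by (intro mult_left_mono poisson_convolution_bound y) simp
  also have "\<dots> = ennreal (D * (\<Prod>l\<in>UNIV. 2 + 2 * y $ l) * decay t)"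
    using D by (simp add: mult.assoc flip: ennreal_mult')
  finally show ?thesis .
qed

text \<open>Tonelli with the integral over \<open>x\<close> taken first: by
  \<open>norm_poisson_integral_le\<close> it is at most a constant times \<open>decay t\<close>,
  which is integrable by the hypothesis on \<open>\<mu>\<close>.\<close>

lemma integrable_pair_poisson:
  fixes f :: "real ^ 'n \<Rightarrow> real"
  assumes sf: "sigma_finite_measure \<mu>" and sets [measurable_cong]: "sets \<mu> = sets borel"
    and int: "integrable \<mu> decay"
    and [measurable]: "f \<in> borel_measurable borel"
    and bd: "\<And>x. \<bar>f x\<bar> \<le> D * decay x" and D: "0 \<le> D" and y: "\<And>l. 0 < y $ l"
  shows "integrable (lborel \<Otimes>\<^sub>M \<mu>) (\<lambda>(x, t). f x * poisson y (x - t))"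
proof (rule integrableI_bounded)
  interpret pair_sigma_finite lborel \<mu>
    by (intro pair_sigma_finite.intro sf lborel.sigma_finite_measure_axioms)
  let ?F = "\<lambda>(x, t). f x * poisson y (x - t)"
  show [measurable]: "?F \<in> borel_measurable (lborel \<Otimes>\<^sub>M \<mu>)"
    by measurable
  have "(\<integral>\<^sup>+p. ennreal (norm (?F p)) \<partial>(lborel \<Otimes>\<^sub>M \<mu>))
      = (\<integral>\<^sup>+t. \<integral>\<^sup>+x. ennreal (norm (?F (x, t))) \<partial>lborel \<partial>\<mu>)"
    by (rule nn_integral_snd[symmetric]) measurable
  also have "\<dots> \<le> (\<integral>\<^sup>+t. ennreal (D * (\<Prod>l\<in>UNIV. 2 + 2 * y $ l) * decay t) \<partial>\<mu>)"
    using norm_poisson_integral_le[OF _ bd D y] by (intro nn_integral_mono) simp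
  also have "\<dots> < \<infinity>"
    using integrable_mult_right[OF int, of "D * (\<Prod>l\<in>UNIV. 2 + 2 * y $ l)"] D y
    by (subst nn_integral_eq_integral) (auto intro!: AE_I2 mult_nonneg_nonneg prod_nonneg decay_nonneg simp: less_imp_le add_nonneg_nonneg)
  finally show "(\<integral>\<^sup>+p. ennreal (norm (?F p)) \<partial>(lborel \<Otimes>\<^sub>M \<mu>)) < \<infinity>" .
qed

lemma tendsto_double_poisson_integral:
  fixes f :: "real ^ 'n \<Rightarrow> real"
  assumes sets [measurable_cong]: "sets \<mu> = sets borel"
    and int: "integrable \<mu> decay"
    and f: "continuous_on UNIV f"
    and bd: "\<And>x. \<bar>f x\<bar> \<le> D * decay x" and D: "0 \<le> D"
    and pos: "\<And>k l. 0 < Y k $ l" and Y: "Y \<longlonglongrightarrow> 0"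
  shows "(\<lambda>k. \<integral>t. \<integral>x. f x * poisson (Y k) (x - t) \<partial>lborel \<partial>\<mu>) \<longlonglongrightarrow> (\<integral>t. f t \<partial>\<mu>)"
proof -
  have [measurable]: "f \<in> borel_measurable borel"
    using f by (rule borel_measurable_continuous_onI)
  \<comment> \<open>A convergent sequence is bounded, so the factors \<open>2 + 2 * Y k $ l\<close>
    stay below \<open>2 + 2 * M\<close> and the majorant \<open>C * decay t\<close> does not depend
    on \<open>k\<close>.\<close>
  obtain M where M: "\<And>k. norm (Y k) \<le> M"
    using convergent_imp_Bseq[of Y] Y by (auto simp: convergent_def Bseq_def)
  define C where "C = D * (\<Prod>l\<in>(UNIV :: 'n set). 2 + 2 * M)"
  have bound: "norm (\<integral>x. f x * poisson (Y k) (x - t) \<partial>lborel) \<le> C * decay t" for k t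
  proof -
    have "Y k $ l \<le> M" for l
      using component_le_norm_cart[of "Y k" l] M[of k] by simp
    then have "D * (\<Prod>l\<in>UNIV. 2 + 2 * Y k $ l) * decay t \<le> C * decay t"
      unfolding C_def using D decay_pos[of t] pos[of k]
      by (intro mult_right_mono mult_left_mono prod_mono) (auto simp: less_imp_le add_nonneg_nonneg)
    moreover have nonneg: "0 \<le> C * decay t"
      unfolding C_def using D decay_pos[of t] order_trans[OF norm_ge_zero M]
      by (intro mult_nonneg_nonneg prod_nonneg) (auto simp: less_imp_le)
    ultimately have le: "(\<integral>\<^sup>+x. ennreal (norm (f x * poisson (Y k) (x - t))) \<partial>lborel) \<le> ennreal (C * decay t)"
      by (intro order_trans[OF norm_poisson_integral_le[OF _ bd D pos]] ennreal_leI) simp_all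
    have "integrable lborel (\<lambda>x. f x * poisson (Y k) (x - t))"
      by (intro integrableI_bounded order.strict_trans1[OF le]) simp_all
    from order_trans[OF integral_norm_bound_ennreal[OF this] le] nonneg show ?thesis
      by (simp add: ennreal_le_iff)
  qed
  \<comment> \<open>The pointwise limit from \<open>tendsto_poisson_integral\<close> asks for a
    uniform bound on \<open>f\<close>, not for decay.\<close>
  have bd': "\<bar>f x\<bar> \<le> D" for x
    using bd[of x] mult_left_mono[OF decay_le_1 D, of x] by simp
  show ?thesis
    by (rule integral_dominated_convergence[where w="\<lambda>t. C * decay t"])
       (use int bound tendsto_poisson_integral[OF pos Y f bd'] in \<open>auto intro!: lborel.borel_measurable_lebesgue_integral\<close>)
qed

text \<open>A Bochner integral is \<open>0\<close> by default when the integrand is not integrable;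
  the two integrability claims certify that the integrals in the limit formula are genuine. The
  filter \<open>at 0 within\<close> the positive orthant expresses the one-sided limit.\<close>

theorem theorem4p2:
  fixes g :: "complex ^ 'n \<Rightarrow> complex"
    and \<mu> :: "(real ^ 'n) measure"
    and \<phi> :: "real ^ 'n \<Rightarrow> real"
    and D :: real
  assumes "Cauchy_type_function g \<mu>"
    and "C1_function \<phi>"
    and "D \<ge> 0"
    and "\<And>x. \<bar>\<phi> x\<bar> \<le> D * (\<Prod>j\<in>UNIV. inverse (1 + (x $ j)\<^sup>2))"
  shows "integrable \<mu> \<phi> \<and>
    (\<forall>y :: real ^ 'n. (\<forall>j. y $ j > 0) \<longrightarrow>
       integrable lborel (\<lambda>x. complex_of_real (\<phi> x) *
         (\<Sum>B\<in>UNIV. (- 1) ^ card B * g (Psi B (complex_vec x y) (complex_vec x y))))) \<and>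
    ((\<lambda>y. 1 / (2 * \<i>) *
        (\<integral>x. complex_of_real (\<phi> x) *
          (\<Sum>B\<in>UNIV. (- 1) ^ card B * g (Psi B (complex_vec x y) (complex_vec x y))) \<partial>lborel))
      \<longlongrightarrow> complex_of_real (\<integral>t. \<phi> t \<partial>\<mu>)) (at 0 within {y. \<forall>j. y $ j > 0})"
proof (intro conjI allI impI)
  note g = assms(1)
  have sets [measurable_cong]: "sets \<mu> = sets borel"
    using g by (simp add: Cauchy_type_function_def)
  have int: "integrable \<mu> decay"
    using g by (rule Cauchy_type_function_integrable_decay)
  have sf: "sigma_finite_measure \<mu>"
    by (rule sigma_finite_measure_nn_integral_pos[of decay])
       (use int in \<open>simp_all add: integrable_iff_bounded decay_pos decay_nonneg\<close>)
  interpret pair_sigma_finite lborel \<mu>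
    by (intro pair_sigma_finite.intro sf lborel.sigma_finite_measure_axioms)
  have cont: "continuous_on UNIV \<phi>"
    using assms(2) unfolding C1_function_def
    by (meson continuous_at_imp_continuous_on has_derivative_continuous)
  then have [measurable]: "\<phi> \<in> borel_measurable borel"
    by (rule borel_measurable_continuous_onI)
  have bd: "\<bar>\<phi> x\<bar> \<le> D * decay x" for x
    using assms(4)[of x] by (simp add: decay_def inverse_eq_divide)
  show "integrable \<mu> \<phi>"
    by (rule Bochner_Integration.integrable_bound[of _ "\<lambda>t. D * decay t"])
       (use int in \<open>auto intro!: AE_I2 order_trans[OF bd]\<close>)
  have pair: "integrable (lborel \<Otimes>\<^sub>M \<mu>) (\<lambda>(x, t). \<phi> x * poisson y (x - t))"
    if "\<And>l. 0 < y $ l" for y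
    using sf sets int _ bd assms(3) that by (rule integrable_pair_poisson) measurable
  have integrand: "complex_of_real (\<phi> x) *
        (\<Sum>B\<in>UNIV. (- 1) ^ card B * g (Psi B (complex_vec x y) (complex_vec x y)))
      = 2 * \<i> * complex_of_real (\<integral>t. \<phi> x * poisson y (x - t) \<partial>\<mu>)"
    if "\<And>l. 0 < y $ l" for x y
    by (simp add: sum_Cauchy_type_Psi[OF g that])
  show "integrable lborel (\<lambda>x. complex_of_real (\<phi> x) *
         (\<Sum>B\<in>UNIV. (- 1) ^ card B * g (Psi B (complex_vec x y) (complex_vec x y))))"
    if "\<forall>j. y $ j > 0" for y
  proof -
    from that have y: "\<And>l. 0 < y $ l" by blast
    show ?thesis
      unfolding integrand[OF y]
      by (intro integrable_mult_right integrable_of_real integrable_fst[OF pair[OF y]])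
  qed
  \<comment> \<open>The prefactor cancels \<open>2 * \<i>\<close>, and Fubini moves the integral
    over \<open>\<mu>\<close> outside, so that \<open>y\<close> occurs only in the inner Poisson
    mean of \<open>\<phi>\<close>.\<close>
  have eq: "1 / (2 * \<i>) * (\<integral>x. complex_of_real (\<phi> x) *
          (\<Sum>B\<in>UNIV. (- 1) ^ card B * g (Psi B (complex_vec x y) (complex_vec x y))) \<partial>lborel)
      = complex_of_real (\<integral>t. \<integral>x. \<phi> x * poisson y (x - t) \<partial>lborel \<partial>\<mu>)"
    if y: "\<And>l. 0 < y $ l" for y
    unfolding integrand[OF y] integral_mult_right_zero integral_complex_of_real
    using Fubini_integral[OF pair[OF y]] by simp
  show "((\<lambda>y. 1 / (2 * \<i>) *
        (\<integral>x. complex_of_real (\<phi> x) *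
          (\<Sum>B\<in>UNIV. (- 1) ^ card B * g (Psi B (complex_vec x y) (complex_vec x y))) \<partial>lborel))
      \<longlongrightarrow> complex_of_real (\<integral>t. \<phi> t \<partial>\<mu>)) (at 0 within {y. \<forall>j. y $ j > 0})"
    \<comment> \<open>Dominated convergence is a statement about sequences, so the limit is tested
      along sequences in the positive orthant.\<close>
    unfolding tendsto_at_iff_sequentially comp_def
  proof (intro allI impI)
    fix Y :: "nat \<Rightarrow> real ^ 'n"
    assume Y: "\<forall>i. Y i \<in> {y. \<forall>j. 0 < y $ j} - {0}" "Y \<longlonglongrightarrow> 0"
    then have pos: "\<And>k l. 0 < Y k $ l" by blast
    show "(\<lambda>k. 1 / (2 * \<i>) *
        (\<integral>x. complex_of_real (\<phi> x) *
          (\<Sum>B\<in>UNIV. (- 1) ^ card B * g (Psi B (complex_vec x (Y k)) (complex_vec x (Y k)))) \<partial>lborel))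
      \<longlonglongrightarrow> complex_of_real (\<integral>t. \<phi> t \<partial>\<mu>)"
      unfolding eq[OF pos]
      by (intro tendsto_of_real tendsto_double_poisson_integral[OF sets int cont bd assms(3) pos Y(2)])
  qed
qed

end
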